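(* Let $\psi_1,\psi_2$ be $\mathcal{T}$-formulas in d-DNNF which are $\mathcal{T}$-reduced with respect to a finite set of atoms $\boldsymbol{\alpha}$ containing their atoms. (a) If $\psi_1,\psi_2$ belong to a form of d-DNNF for which $\psi_1\equiv_{\mathcal{B}}\psi_2$ can be decided in polynomial time (e.g., OBDDs with the same variable ordering, or SDDs with the same vtree), then $\psi_1\equiv_{\mathcal{T}}\psi_2$ can be decided in polynomial time. (b) If $\psi_1,\psi_2$ belong to a form of d-DNNF for which $\psi_1\models_p\psi_2$ can be decided in polynomial time (e.g., OBDDs with the same variable ordering, or SDDs with the same vtree), then $\psi_1\models_{\mathcal{T}}\psi_2$ can be decided in polynomial time.
   Context: $\mathcal{T}$-formulas are quantifier-free formulas built by Boolean connectives from $\mathcal{T}$-atoms and Boolean atoms, represented as DAGs. The Boolean abstraction maps each atom bijectively to a fresh Boolean variable; $\psi\models_p\chi$ means the abstraction of $\psi$ propositionally entails that of $\chi$, and $\equiv_{\mathcal{B}}$ is mutual $\models_p$; $\models_{\mathcal{T}},\equiv_{\mathcal{T}}$ are entailment/equivalence modulo $\mathcal{T}$. d-DNNF: negation normal form in which children of every $\wedge$-node share no atoms and children of every $\vee$-node are pairwise propositionally inconsistent; a $\mathcal{T}$-formula is in a given form iff its Boolean abstraction is. A total truth assignment on $\boldsymbol{\alpha}$ is a conjunction containing, for each $a\in\boldsymbol{\alpha}$, exactly one of $a,\neg a$. $P_{\boldsymbol{\alpha}}(\psi)$ is the set of $\mathcal{T}$-unsatisfiable total truth assignments $\rho$ on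 $\boldsymbol{\alpha}$ with $\rho\models_p\psi$; $\psi$ is $\mathcal{T}$-reduced with respect to $\boldsymbol{\alpha}$ iff $P_{\boldsymbol{\alpha}}(\psi)=\emptyset$. *)

theory Defs
  imports Main "HOL-Computational_Algebra.Polynomial"
begin

section \<open>Quantifier-free formulas\<close>

datatype (atoms: 'x) fm =
    Tru | Fls
  | Atm 'x
  | Neg "'x fm"
  | Conj "'x fm list"
  | Disj "'x fm list"
  | Imp "'x fm" "'x fm"
  | Iff "'x fm" "'x fm"

fun eval :: "('x \<Rightarrow> bool) \<Rightarrow> 'x fm \<Rightarrow> bool" where
  "eval v Tru \<longleftrightarrow> True"
| "eval v Fls \<longleftrightarrow> False"
| "eval v (Atm x) \<longleftrightarrow> v x"
| "eval v (Neg \<phi>) \<longleftrightarrow> \<not> eval v \<phi>"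
| "eval v (Conj \<phi>s) \<longleftrightarrow> (\<forall>\<phi> \<in> set \<phi>s. eval v \<phi>)"
| "eval v (Disj \<phi>s) \<longleftrightarrow> (\<exists>\<phi> \<in> set \<phi>s. eval v \<phi>)"
| "eval v (Imp \<phi> \<chi>) \<longleftrightarrow> (eval v \<phi> \<longrightarrow> eval v \<chi>)"
| "eval v (Iff \<phi> \<chi>) \<longleftrightarrow> (eval v \<phi> \<longleftrightarrow> eval v \<chi>)"

section \<open>Formulas represented as DAGs\<close>

text \<open>A DAG is the list of its nodes in a topological order (children before parents), children
  being referred to by their position in the list; the last node is the root.\<close>

datatype (node_atoms: 'x) node =
    NTru | NFls
  | NAtm 'x
  | NNeg nat
  | NConj "nat list"
  | NDisj "nat list"
  | NImp nat nat
  | NIff nat nat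

type_synonym 'x dag = "'x node list"

fun children :: "'x node \<Rightarrow> nat list" where
  "children NTru = []"
| "children NFls = []"
| "children (NAtm x) = []"
| "children (NNeg i) = [i]"
| "children (NConj is) = is"
| "children (NDisj is) = is"
| "children (NImp i j) = [i, j]"
| "children (NIff i j) = [i, j]"

text \<open>The third conjunct says that the last node is the only one without a parent; together with
  the second one it makes every node reachable from the root.\<close>

definition wf_dag :: "'x dag \<Rightarrow> bool" where
  "wf_dag g \<longleftrightarrow> g \<noteq> [] \<and>
     (\<forall>i < length g. \<forall>j \<in> set (children (g ! i)). j < i) \<and>
     (\<forall>j < length g - 1. \<exists>i < length g. j \<in> set (children (g ! i)))"

fun node_fm :: "'x fm list \<Rightarrow> 'x node \<Rightarrow> 'x fm" where
  "node_fm \<phi>s NTru = Tru"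
| "node_fm \<phi>s NFls = Fls"
| "node_fm \<phi>s (NAtm x) = Atm x"
| "node_fm \<phi>s (NNeg i) = Neg (\<phi>s ! i)"
| "node_fm \<phi>s (NConj is) = Conj (map ((!) \<phi>s) is)"
| "node_fm \<phi>s (NDisj is) = Disj (map ((!) \<phi>s) is)"
| "node_fm \<phi>s (NImp i j) = Imp (\<phi>s ! i) (\<phi>s ! j)"
| "node_fm \<phi>s (NIff i j) = Iff (\<phi>s ! i) (\<phi>s ! j)"

definition formula_of :: "'x dag \<Rightarrow> 'x fm" where
  "formula_of g = last (foldl (\<lambda>\<phi>s n. \<phi>s @ [node_fm \<phi>s n]) [] g)"

section \<open>Boolean abstraction and d-DNNF\<close>

text \<open>The type of fresh Boolean variables is a disjoint copy of the type of atoms.\<close>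

datatype 'a bvar = BVar 'a

definition babs :: "'a fm \<Rightarrow> 'a bvar fm" where
  "babs \<phi> = map_fm BVar \<phi>"

definition babs_dag :: "'a dag \<Rightarrow> 'a bvar dag" where
  "babs_dag g = map (map_node BVar) g"

definition entails_p :: "'a fm \<Rightarrow> 'a fm \<Rightarrow> bool" where
  "entails_p \<phi> \<chi> \<longleftrightarrow> (\<forall>v. eval v (babs \<phi>) \<longrightarrow> eval v (babs \<chi>))"

definition equiv_B :: "'a fm \<Rightarrow> 'a fm \<Rightarrow> bool" where
  "equiv_B \<phi> \<chi> \<longleftrightarrow> entails_p \<phi> \<chi> \<and> entails_p \<chi> \<phi>"

fun nnf :: "'x fm \<Rightarrow> bool" where
  "nnf Tru \<longleftrightarrow> True"
| "nnf Fls \<longleftrightarrow> True"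
| "nnf (Atm x) \<longleftrightarrow> True"
| "nnf (Neg \<phi>) \<longleftrightarrow> (\<exists>x. \<phi> = Atm x)"
| "nnf (Conj \<phi>s) \<longleftrightarrow> (\<forall>\<phi> \<in> set \<phi>s. nnf \<phi>)"
| "nnf (Disj \<phi>s) \<longleftrightarrow> (\<forall>\<phi> \<in> set \<phi>s. nnf \<phi>)"
| "nnf (Imp \<phi> \<chi>) \<longleftrightarrow> False"
| "nnf (Iff \<phi> \<chi>) \<longleftrightarrow> False"

fun decomposable :: "'x fm \<Rightarrow> bool" where
  "decomposable (Neg \<phi>) \<longleftrightarrow> decomposable \<phi>"
| "decomposable (Conj \<phi>s) \<longleftrightarrow>
     sorted_wrt (\<lambda>\<phi> \<chi>. atoms \<phi> \<inter> atoms \<chi> = {}) \<phi>s \<and> (\<forall>\<phi> \<in> set \<phi>s. decomposable \<phi>)"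
| "decomposable (Disj \<phi>s) \<longleftrightarrow> (\<forall>\<phi> \<in> set \<phi>s. decomposable \<phi>)"
| "decomposable (Imp \<phi> \<chi>) \<longleftrightarrow> decomposable \<phi> \<and> decomposable \<chi>"
| "decomposable (Iff \<phi> \<chi>) \<longleftrightarrow> decomposable \<phi> \<and> decomposable \<chi>"
| "decomposable _ \<longleftrightarrow> True"

fun deterministic :: "'x fm \<Rightarrow> bool" where
  "deterministic (Neg \<phi>) \<longleftrightarrow> deterministic \<phi>"
| "deterministic (Conj \<phi>s) \<longleftrightarrow> (\<forall>\<phi> \<in> set \<phi>s. deterministic \<phi>)"
| "deterministic (Disj \<phi>s) \<longleftrightarrow>
     sorted_wrt (\<lambda>\<phi> \<chi>. \<not> (\<exists>v. eval v \<phi> \<and> eval v \<chi>)) \<phi>s \<and> (\<forall>\<phi> \<in> set \<phi>s. deterministic \<phi>)"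
| "deterministic (Imp \<phi> \<chi>) \<longleftrightarrow> deterministic \<phi> \<and> deterministic \<chi>"
| "deterministic (Iff \<phi> \<chi>) \<longleftrightarrow> deterministic \<phi> \<and> deterministic \<chi>"
| "deterministic _ \<longleftrightarrow> True"

definition d_DNNF :: "'x dag \<Rightarrow> bool" where
  "d_DNNF g \<longleftrightarrow> wf_dag g \<and> nnf (formula_of g) \<and> decomposable (formula_of g) \<and>
     deterministic (formula_of g)"

text \<open>A form of d-DNNF is a relation between propositional DAGs rather than a set of DAGs, so that
  it can express conditions linking the two, such as having the same variable ordering or the
  same vtree.\<close>

definition d_DNNF_form :: "('x dag \<times> 'x dag) set \<Rightarrow> bool" where
  "d_DNNF_form F \<longleftrightarrow> (\<forall>(g1, g2) \<in> F. d_DNNF g1 \<and> d_DNNF g2)"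

section \<open>Many-sorted first-order theories\<close>

datatype ('f, 'v) trm = Var 'v | App 'f "('f, 'v) trm list"

datatype ('f, 'p, 'v, 'b) atom =
    Pred 'p "('f, 'v) trm list"
  | Eq "('f, 'v) trm" "('f, 'v) trm"
  | BoolAtom 'b

record ('s, 'f, 'p, 'v) signature =
  var_sort :: "'v \<Rightarrow> 's"
  fun_args :: "'f \<Rightarrow> 's list"
  fun_sort :: "'f \<Rightarrow> 's"
  pred_args :: "'p \<Rightarrow> 's list"

inductive has_sort :: "('s, 'f, 'p, 'v) signature \<Rightarrow> ('f, 'v) trm \<Rightarrow> 's \<Rightarrow> bool"
  for \<Sigma> where
  "has_sort \<Sigma> (Var x) (var_sort \<Sigma> x)"
| "list_all2 (has_sort \<Sigma>) ts (fun_args \<Sigma> f) \<Longrightarrow> has_sort \<Sigma> (App f ts) (fun_sort \<Sigma> f)"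

fun wf_atom :: "('s, 'f, 'p, 'v) signature \<Rightarrow> ('f, 'p, 'v, 'b) atom \<Rightarrow> bool" where
  "wf_atom \<Sigma> (Pred p ts) \<longleftrightarrow> list_all2 (has_sort \<Sigma>) ts (pred_args \<Sigma> p)"
| "wf_atom \<Sigma> (Eq t u) \<longleftrightarrow> (\<exists>s. has_sort \<Sigma> t s \<and> has_sort \<Sigma> u s)"
| "wf_atom \<Sigma> (BoolAtom b) \<longleftrightarrow> True"

record ('s, 'f, 'p, 'd) model =
  dom_of :: "'s \<Rightarrow> 'd set"
  fun_of :: "'f \<Rightarrow> 'd list \<Rightarrow> 'd"
  pred_of :: "'p \<Rightarrow> 'd list \<Rightarrow> bool"

definition wf_model :: "('s, 'f, 'p, 'v) signature \<Rightarrow> ('s, 'f, 'p, 'd) model \<Rightarrow> bool" where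
  "wf_model \<Sigma> M \<longleftrightarrow> (\<forall>s. dom_of M s \<noteq> {}) \<and>
     (\<forall>f ds. list_all2 (\<lambda>d s. d \<in> dom_of M s) ds (fun_args \<Sigma> f) \<longrightarrow>
        fun_of M f ds \<in> dom_of M (fun_sort \<Sigma> f))"

text \<open>A theory is given by its set of models.\<close>

definition is_theory :: "('s, 'f, 'p, 'v) signature \<Rightarrow> ('s, 'f, 'p, 'd) model set \<Rightarrow> bool" where
  "is_theory \<Sigma> T \<longleftrightarrow> (\<forall>M \<in> T. wf_model \<Sigma> M)"

text \<open>An interpretation modulo a theory: a model of the theory, a sort-respecting assignment to the
  variables, and an arbitrary assignment to the Boolean atoms.\<close>

type_synonym ('s, 'f, 'p, 'v, 'b, 'd) interp =
  "('s, 'f, 'p, 'd) model \<times> ('v \<Rightarrow> 'd) \<times> ('b \<Rightarrow> bool)"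

definition interps ::
  "('s, 'f, 'p, 'v) signature \<Rightarrow> ('s, 'f, 'p, 'd) model set \<Rightarrow> ('s, 'f, 'p, 'v, 'b, 'd) interp set"
  where
  "interps \<Sigma> T = {(M, \<eta>, \<beta>). M \<in> T \<and> (\<forall>x. \<eta> x \<in> dom_of M (var_sort \<Sigma> x))}"

fun trm_val :: "('s, 'f, 'p, 'd) model \<Rightarrow> ('v \<Rightarrow> 'd) \<Rightarrow> ('f, 'v) trm \<Rightarrow> 'd" where
  "trm_val M \<eta> (Var x) = \<eta> x"
| "trm_val M \<eta> (App f ts) = fun_of M f (map (trm_val M \<eta>) ts)"

fun atom_val :: "('s, 'f, 'p, 'v, 'b, 'd) interp \<Rightarrow> ('f, 'p, 'v, 'b) atom \<Rightarrow> bool" where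
  "atom_val (M, \<eta>, \<beta>) (Pred p ts) \<longleftrightarrow> pred_of M p (map (trm_val M \<eta>) ts)"
| "atom_val (M, \<eta>, \<beta>) (Eq t u) \<longleftrightarrow> trm_val M \<eta> t = trm_val M \<eta> u"
| "atom_val (M, \<eta>, \<beta>) (BoolAtom b) \<longleftrightarrow> \<beta> b"

definition satisfiable_T ::
  "('s, 'f, 'p, 'v) signature \<Rightarrow> ('s, 'f, 'p, 'd) model set \<Rightarrow> ('f, 'p, 'v, 'b) atom fm \<Rightarrow> bool" where
  "satisfiable_T \<Sigma> T \<phi> \<longleftrightarrow> (\<exists>I \<in> interps \<Sigma> T. eval (atom_val I) \<phi>)"

definition entails_T ::
  "('s, 'f, 'p, 'v) signature \<Rightarrow> ('s, 'f, 'p, 'd) model set \<Rightarrow>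
     ('f, 'p, 'v, 'b) atom fm \<Rightarrow> ('f, 'p, 'v, 'b) atom fm \<Rightarrow> bool" where
  "entails_T \<Sigma> T \<phi> \<chi> \<longleftrightarrow>
     (\<forall>I \<in> interps \<Sigma> T. eval (atom_val I) \<phi> \<longrightarrow> eval (atom_val I) \<chi>)"

definition equiv_T ::
  "('s, 'f, 'p, 'v) signature \<Rightarrow> ('s, 'f, 'p, 'd) model set \<Rightarrow>
     ('f, 'p, 'v, 'b) atom fm \<Rightarrow> ('f, 'p, 'v, 'b) atom fm \<Rightarrow> bool" where
  "equiv_T \<Sigma> T \<phi> \<chi> \<longleftrightarrow> entails_T \<Sigma> T \<phi> \<chi> \<and> entails_T \<Sigma> T \<chi> \<phi>"

definition T_dag :: "('s, 'f, 'p, 'v) signature \<Rightarrow> ('f, 'p, 'v, 'b) atom dag \<Rightarrow> bool" where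
  "T_dag \<Sigma> g \<longleftrightarrow> wf_dag g \<and> (\<forall>a \<in> atoms (formula_of g). wf_atom \<Sigma> a)"

section \<open>T-reduced formulas\<close>

definition total_assignment :: "'a set \<Rightarrow> 'a fm \<Rightarrow> bool" where
  "total_assignment \<alpha> \<rho> \<longleftrightarrow> (\<exists>ls. \<rho> = Conj ls \<and> distinct ls \<and>
     set ls \<subseteq> Atm ` \<alpha> \<union> (Neg \<circ> Atm) ` \<alpha> \<and>
     (\<forall>a \<in> \<alpha>. (Atm a \<in> set ls) \<noteq> (Neg (Atm a) \<in> set ls)))"

definition P_set ::
  "('s, 'f, 'p, 'v) signature \<Rightarrow> ('s, 'f, 'p, 'd) model set \<Rightarrow> ('f, 'p, 'v, 'b) atom set \<Rightarrow>
     ('f, 'p, 'v, 'b) atom fm \<Rightarrow> ('f, 'p, 'v, 'b) atom fm set" where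
  "P_set \<Sigma> T \<alpha> \<psi> = {\<rho>. total_assignment \<alpha> \<rho> \<and> \<not> satisfiable_T \<Sigma> T \<rho> \<and> entails_p \<rho> \<psi>}"

definition T_reduced ::
  "('s, 'f, 'p, 'v) signature \<Rightarrow> ('s, 'f, 'p, 'd) model set \<Rightarrow> ('f, 'p, 'v, 'b) atom set \<Rightarrow>
     ('f, 'p, 'v, 'b) atom fm \<Rightarrow> bool" where
  "T_reduced \<Sigma> T \<alpha> \<psi> \<longleftrightarrow> P_set \<Sigma> T \<alpha> \<psi> = {}"

definition form_pairs ::
  "('s, 'f, 'p, 'v) signature \<Rightarrow>
     (('f, 'p, 'v, 'b) atom bvar dag \<times> ('f, 'p, 'v, 'b) atom bvar dag) set \<Rightarrow>
     (('f, 'p, 'v, 'b) atom dag \<times> ('f, 'p, 'v, 'b) atom dag) set" where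
  "form_pairs \<Sigma> F =
     {(g1, g2). T_dag \<Sigma> g1 \<and> T_dag \<Sigma> g2 \<and> (babs_dag g1, babs_dag g2) \<in> F}"

definition reduced_form_pairs ::
  "('s, 'f, 'p, 'v) signature \<Rightarrow> ('s, 'f, 'p, 'd) model set \<Rightarrow>
     (('f, 'p, 'v, 'b) atom bvar dag \<times> ('f, 'p, 'v, 'b) atom bvar dag) set \<Rightarrow>
     (('f, 'p, 'v, 'b) atom dag \<times> ('f, 'p, 'v, 'b) atom dag) set" where
  "reduced_form_pairs \<Sigma> T F =
     {(g1, g2) \<in> form_pairs \<Sigma> F. \<exists>\<alpha>. finite \<alpha> \<and> (\<forall>a \<in> \<alpha>. wf_atom \<Sigma> a) \<and>
        atoms (formula_of g1) \<union> atoms (formula_of g2) \<subseteq> \<alpha> \<and>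
        T_reduced \<Sigma> T \<alpha> (formula_of g1) \<and> T_reduced \<Sigma> T \<alpha> (formula_of g2)}"

section \<open>Polynomial-time decidability by Turing machines\<close>

datatype token =
    Bit bool | TruTag | FlsTag | AtmTag | NegTag | ConjTag | DisjTag | ImpTag | IffTag
  | IndexTag | EndTag

datatype symbol = Blank | Input token | Work nat

datatype move = MoveLeft | Stay | MoveRight

record machine =
  states :: "nat set"
  alphabet :: "symbol set"
  start :: nat
  accept :: nat
  reject :: nat
  delta :: "nat \<Rightarrow> symbol \<Rightarrow> nat \<times> symbol \<times> move"

definition wf_machine :: "machine \<Rightarrow> bool" where
  "wf_machine M \<longleftrightarrow> finite (states M) \<and> finite (alphabet M) \<and>
     insert Blank (range Input) \<subseteq> alphabet M \<and>
     {start M, accept M, reject M} \<subseteq> states M \<and> accept M \<noteq> reject M \<and>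
     (\<forall>q \<in> states M. \<forall>s \<in> alphabet M.
        fst (delta M q s) \<in> states M \<and> fst (snd (delta M q s)) \<in> alphabet M)"

text \<open>A configuration consists of the state, the contents of the two-way infinite tape, and the
  position of the head.\<close>

type_synonym config = "nat \<times> (int \<Rightarrow> symbol) \<times> int"

fun move_head :: "move \<Rightarrow> int \<Rightarrow> int" where
  "move_head MoveLeft h = h - 1"
| "move_head Stay h = h"
| "move_head MoveRight h = h + 1"

fun step :: "machine \<Rightarrow> config \<Rightarrow> config" where
  "step M (q, tape, h) =
     (if q = accept M \<or> q = reject M then (q, tape, h)
      else case delta M q (tape h) of (q', s, d) \<Rightarrow> (q', tape(h := s), move_head d h))"

definition initial :: "machine \<Rightarrow> token list \<Rightarrow> config" where
  "initial M w =
     (start M,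
      \<lambda>i. if 0 \<le> i \<and> i < int (length w) then Input (w ! nat i) else Blank,
      0)"

definition state_after :: "machine \<Rightarrow> token list \<Rightarrow> nat \<Rightarrow> nat" where
  "state_after M w t = fst ((step M ^^ t) (initial M w))"

text \<open>Decidability in polynomial time of the problem \<open>Q\<close> on instances from \<open>D\<close> (a promise
  problem), where \<open>code\<close> encodes the instances as words.\<close>

definition polytime_decidable_on :: "'i set \<Rightarrow> ('i \<Rightarrow> token list) \<Rightarrow> ('i \<Rightarrow> bool) \<Rightarrow> bool" where
  "polytime_decidable_on D code Q \<longleftrightarrow>
     (\<exists>M (p :: nat poly). wf_machine M \<and>
        (\<forall>x \<in> D. \<exists>t \<le> poly p (length (code x)).
           state_after M (code x) t = (if Q x then accept M else reject M)))"

section \<open>Encoding of DAGs as words\<close>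

fun enc_nat :: "nat \<Rightarrow> token list" where
  "enc_nat n = (if n = 0 then [] else enc_nat (n div 2) @ [Bit (odd n)])"

declare enc_nat.simps [simp del]

definition enc_index :: "nat \<Rightarrow> token list" where
  "enc_index i = IndexTag # enc_nat i"

fun enc_node :: "('x \<Rightarrow> bool list) \<Rightarrow> 'x node \<Rightarrow> token list" where
  "enc_node e NTru = [TruTag]"
| "enc_node e NFls = [FlsTag]"
| "enc_node e (NAtm x) = AtmTag # map Bit (e x)"
| "enc_node e (NNeg i) = NegTag # enc_index i"
| "enc_node e (NConj is) = ConjTag # concat (map enc_index is)"
| "enc_node e (NDisj is) = DisjTag # concat (map enc_index is)"
| "enc_node e (NImp i j) = ImpTag # enc_index i @ enc_index j"
| "enc_node e (NIff i j) = IffTag # enc_index i @ enc_index j"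

definition enc_dag :: "('x \<Rightarrow> bool list) \<Rightarrow> 'x dag \<Rightarrow> token list" where
  "enc_dag e g = concat (map (enc_node e) g) @ [EndTag]"

definition enc_pair :: "('x \<Rightarrow> bool list) \<Rightarrow> 'x dag \<times> 'x dag \<Rightarrow> token list" where
  "enc_pair e = (\<lambda>(g1, g2). enc_dag e g1 @ enc_dag e g2)"

end

theory Submission
  imports Defs
begin

text \<open>On formulas that are reduced with respect to a common \<open>\<alpha>\<close>, propositional entailment and
  entailment modulo the theory coincide: a propositional countermodel of an entailment restricts to
  a total assignment on \<open>\<alpha>\<close> that propositionally entails the premise, so reducedness makes it
  satisfiable modulo the theory, and an interpretation satisfying it is a countermodel modulo the
  theory. The machine deciding the propositional problem therefore also decides the other one.\<close>

lemma eval_cong: "(\<And>a. a \<in> atoms \<phi> \<Longrightarrow> v a = w a) \<Longrightarrow> eval v \<phi> = eval w \<phi>"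
  by (induction \<phi>) auto

lemma eval_map_fm: "eval v (map_fm f \<phi>) = eval (v \<circ> f) \<phi>"
  by (induction \<phi>) auto

text \<open>Abstraction only renames atoms bijectively, so valuations of atoms can replace
  valuations of Boolean variables from here on.\<close>

lemma entails_p_iff_eval: "entails_p \<phi> \<chi> \<longleftrightarrow> (\<forall>v. eval v \<phi> \<longrightarrow> eval v \<chi>)"
proof
  assume *: "entails_p \<phi> \<chi>"
  show "\<forall>v. eval v \<phi> \<longrightarrow> eval v \<chi>"
  proof
    fix v :: "'a \<Rightarrow> bool"
    \<comment> \<open>\<open>case_bvar v\<close> transports \<open>v\<close> to the Boolean
      variables by undoing \<open>BVar\<close>.\<close>
    have "(case_bvar v \<circ> BVar) = v" by auto
    with * show "eval v \<phi> \<longrightarrow> eval v \<chi>"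
      unfolding entails_p_def babs_def eval_map_fm by metis
  qed
qed (simp add: entails_p_def babs_def eval_map_fm)

text \<open>Each interpretation \<open>I\<close> induces the valuation \<open>atom_val I\<close> of
  the atoms.\<close>

lemma entails_p_imp_entails_T: "entails_p \<phi> \<chi> \<Longrightarrow> entails_T \<Sigma> T \<phi> \<chi>"
  by (simp add: entails_p_iff_eval entails_T_def)

text \<open>Finiteness lets the literals true under \<open>v\<close> be listed in one conjunction,
  whose models are the valuations that agree with \<open>v\<close> on \<alpha>.\<close>

lemma total_assignment_of_valuation:
  assumes "finite \<alpha>"
  obtains \<rho> where "total_assignment \<alpha> \<rho>"
    and "\<And>w. eval w \<rho> \<longleftrightarrow> (\<forall>a\<in>\<alpha>. w a = v a)"
proof -
  obtain as where as: "set as = \<alpha>" "distinct as"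
    using finite_distinct_list[OF assms] by blast
  define lit where "lit a = (if v a then Atm a else Neg (Atm a))" for a
  \<comment> \<open>Either literal determines its atom; this gives the distinctness that
    \<open>total_assignment\<close> demands.\<close>
  have "inj lit"
    by (auto simp: inj_def lit_def split: if_splits)
  then have "distinct (map lit as)"
    using as(2) by (auto simp: distinct_map intro: inj_on_subset)
  moreover have "(Atm a \<in> lit ` \<alpha>) \<noteq> (Neg (Atm a) \<in> lit ` \<alpha>)" if "a \<in> \<alpha>" for a
    using that by (auto simp: lit_def image_iff split: if_splits)
  moreover have "lit ` \<alpha> \<subseteq> Atm ` \<alpha> \<union> (Neg \<circ> Atm) ` \<alpha>"
    by (auto simp: lit_def)
  ultimately have "total_assignment \<alpha> (Conj (map lit as))"
    unfolding total_assignment_def using as(1) by auto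
  moreover have "eval w (lit a) \<longleftrightarrow> w a = v a" for w a
    by (simp add: lit_def)
  then have "eval w (Conj (map lit as)) \<longleftrightarrow> (\<forall>a\<in>\<alpha>. w a = v a)" for w
    using as(1) by simp
  ultimately show thesis by (rule that)
qed

lemma entails_T_iff_entails_p_if_T_reduced:
  assumes "finite \<alpha>" "atoms \<phi> \<union> atoms \<chi> \<subseteq> \<alpha>" "T_reduced \<Sigma> T \<alpha> \<phi>"
  shows "entails_T \<Sigma> T \<phi> \<chi> \<longleftrightarrow> entails_p \<phi> \<chi>"
proof
  assume T: "entails_T \<Sigma> T \<phi> \<chi>"
  show "entails_p \<phi> \<chi>"
    unfolding entails_p_iff_eval
  proof (intro allI impI)
    fix v assume v: "eval v \<phi>"
    obtain \<rho> where \<rho>: "total_assignment \<alpha> \<rho>" "\<And>w. eval w \<rho> \<longleftrightarrow> (\<forall>a\<in>\<alpha>. w a = v a)"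
      using total_assignment_of_valuation[OF assms(1)] by blast
    \<comment> \<open>Since \<alpha> covers the atoms of both formulas, \<rho> fixes both truth
      values: that of \<phi> puts \<rho> below \<phi>, that of \<chi> carries the conclusion from
      \<open>I\<close> back to \<open>v\<close>.\<close>
    have agree: "eval w \<phi> = eval v \<phi>" "eval w \<chi> = eval v \<chi>" if "eval w \<rho>" for w
      using that assms(2) \<rho>(2) by (auto intro!: eval_cong)
    have "entails_p \<rho> \<phi>"
      using v agree(1) by (auto simp: entails_p_iff_eval)
    \<comment> \<open>Otherwise \<rho> would lie in the empty set
      \<open>P_set \<Sigma> T \<alpha> \<phi>\<close>.\<close>
    with \<rho>(1) assms(3) have "satisfiable_T \<Sigma> T \<rho>"
      by (auto simp: T_reduced_def P_set_def)
    then obtain I where "I \<in> interps \<Sigma> T" "eval (atom_val I) \<rho>"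
      by (auto simp: satisfiable_T_def)
    with T v agree show "eval v \<chi>"
      by (auto simp: entails_T_def)
  qed
qed (rule entails_p_imp_entails_T)

lemma reduced_form_pairs_entails_T_iff:
  assumes "(g1, g2) \<in> reduced_form_pairs \<Sigma> T F"
  shows "entails_T \<Sigma> T (formula_of g1) (formula_of g2) \<longleftrightarrow>
      entails_p (formula_of g1) (formula_of g2)"
    and "equiv_T \<Sigma> T (formula_of g1) (formula_of g2) \<longleftrightarrow>
      equiv_B (formula_of g1) (formula_of g2)"
proof -
  obtain \<alpha> where \<alpha>: "finite \<alpha>" "atoms (formula_of g1) \<union> atoms (formula_of g2) \<subseteq> \<alpha>"
    "T_reduced \<Sigma> T \<alpha> (formula_of g1)" "T_reduced \<Sigma> T \<alpha> (formula_of g2)"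
    using assms unfolding reduced_form_pairs_def by blast
  note 12 = entails_T_iff_entails_p_if_T_reduced[OF \<alpha>(1,2,3)]
  have "atoms (formula_of g2) \<union> atoms (formula_of g1) \<subseteq> \<alpha>"
    using \<alpha>(2) by blast
  \<comment> \<open>The converse direction has \<open>formula_of g2\<close> as premise, so it uses
    the reducedness of that formula.\<close>
  note 21 = entails_T_iff_entails_p_if_T_reduced[OF \<alpha>(1) this \<alpha>(4)]
  show "entails_T \<Sigma> T (formula_of g1) (formula_of g2) \<longleftrightarrow>
      entails_p (formula_of g1) (formula_of g2)"
    by (rule 12)
  show "equiv_T \<Sigma> T (formula_of g1) (formula_of g2) \<longleftrightarrow>
      equiv_B (formula_of g1) (formula_of g2)"
    by (simp add: equiv_T_def equiv_B_def 12 21)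
qed

text \<open>The same machine and time bound work: fewer inputs are promised, and on those the
  answers agree.\<close>

lemma polytime_decidable_on_subset:
  assumes "polytime_decidable_on D code Q" "D' \<subseteq> D" "\<And>x. x \<in> D' \<Longrightarrow> Q' x = Q x"
  shows "polytime_decidable_on D' code Q'"
  using assms unfolding polytime_decidable_on_def by (metis subsetD)

theorem theorem5p3:
  fixes \<Sigma> :: "('s, 'f, 'p, 'v) signature"
    and T :: "('s, 'f, 'p, 'd) model set"
    and enc :: "('f, 'p, 'v, 'b) atom \<Rightarrow> bool list"
    and F :: "(('f, 'p, 'v, 'b) atom bvar dag \<times> ('f, 'p, 'v, 'b) atom bvar dag) set"
  assumes "is_theory \<Sigma> T"
    and "inj_on enc {a. wf_atom \<Sigma> a}"
    and "d_DNNF_form F"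
  shows "(polytime_decidable_on (form_pairs \<Sigma> F) (enc_pair enc)
            (\<lambda>(\<psi>1, \<psi>2). equiv_B (formula_of \<psi>1) (formula_of \<psi>2)) \<longrightarrow>
          polytime_decidable_on (reduced_form_pairs \<Sigma> T F) (enc_pair enc)
            (\<lambda>(\<psi>1, \<psi>2). equiv_T \<Sigma> T (formula_of \<psi>1) (formula_of \<psi>2))) \<and>
         (polytime_decidable_on (form_pairs \<Sigma> F) (enc_pair enc)
            (\<lambda>(\<psi>1, \<psi>2). entails_p (formula_of \<psi>1) (formula_of \<psi>2)) \<longrightarrow>
          polytime_decidable_on (reduced_form_pairs \<Sigma> T F) (enc_pair enc)
            (\<lambda>(\<psi>1, \<psi>2). entails_T \<Sigma> T (formula_of \<psi>1) (formula_of \<psi>2)))"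
proof -
  have "reduced_form_pairs \<Sigma> T F \<subseteq> form_pairs \<Sigma> F"
    by (auto simp: reduced_form_pairs_def)
  then show ?thesis
    by (auto elim!: polytime_decidable_on_subset simp: reduced_form_pairs_entails_T_iff)
qed

end
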